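(* Let $p>1$, let $f,F$ be real numbers with $0<f^p\leq F$, and let $k\in(0,1]$. Consider \[ S_k(f,F)=\sup\left\{\int_0^k\left(\frac1t\int_0^t g(u)\,du\right)^p dt \;:\; g:(0,1]\to[0,+\infty)\ \text{non-increasing},\ \int_0^1 g=f,\ \int_0^1 g^p=F\right\}. \] Then there exists a function $g=g_k:(0,1]\to[0,+\infty)$ which is non-increasing and continuous, satisfies $\int_0^1 g=f$ and $\int_0^1 g^p=F$, and for which $\int_0^k\left(\frac1t\int_0^t g\right)^p dt=S_k(f,F)$, i.e. the supremum is attained.
   Context: In the paper this supremum equals the Bellman function $B_p^{\mathcal T}(f,F,k)$ of the dyadic maximal operator on a tree, but the claim above is purely about functions on $(0,1]$ with Lebesgue measure. *)

theory Defs
  imports "HOL-Analysis.Analysis"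
begin

definition admissible :: "real \<Rightarrow> real \<Rightarrow> real \<Rightarrow> (real \<Rightarrow> real) \<Rightarrow> bool" where
  "admissible p f F g \<longleftrightarrow>
     (\<forall>x\<in>{0<..1}. 0 \<le> g x) \<and>
     (\<forall>x\<in>{0<..1}. \<forall>y\<in>{0<..1}. x \<le> y \<longrightarrow> g y \<le> g x) \<and>
     set_integrable lborel {0<..1::real} g \<and>
     set_integrable lborel {0<..1::real} (\<lambda>x. g x powr p) \<and>
     (LINT x:{0<..1}|lborel. g x) = f \<and>
     (LINT x:{0<..1}|lborel. g x powr p) = F"

text \<open>The functional  int_0^k ((1/t) int_0^t g)^p dt, taken as a
  nonnegative (extended-real) integral so that it is always defined.\<close>
definition hardy_functional :: "real \<Rightarrow> real \<Rightarrow> (real \<Rightarrow> real) \<Rightarrow> ennreal" where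
  "hardy_functional p k g =
     (\<integral>\<^sup>+ t\<in>{0<..k}. ennreal (((1 / t) * (LINT u:{0<..t}|lborel. g u)) powr p) \<partial>lborel)"

definition S_sup :: "real \<Rightarrow> real \<Rightarrow> real \<Rightarrow> real \<Rightarrow> ennreal" where
  "S_sup p k f F = (SUP g\<in>{g. admissible p f F g}. hardy_functional p k g)"

end

(*
  Put w = 1 / (s + 1) and let Tg(t) = (1/t) int_0^t g.  The maximiser is a multiple of
  min(x, k) powr s: on (0, k] this is a power with Tg = w g, and on (k, 1] it is constant.  The
  exponent s in (-1/p, 0] is determined by the ratio F / f^p.

  Upper bound, for every w > 1: formally, integrating the derivative of t (Tg)^p and using Young's inequality
  with equality case Tg = w g gives
    k (Tg(k))^p + (p - 1) (1 - 1/w) int_0^k (Tg)^p <= w^(p-1) int_0^k g^p.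
  Estimating (Tg(k))^p and int_k^1 g^p from below by tangents at wA and A, where
  A = f / (k w + 1 - k), bounds the functional by a quantity depending only on p, f, F, k and w,
  and the maximiser attains it.  When F = f^p the maximiser is constant, w = 1, and the bound is
  recovered in the limit w -> 1.
*)
theory Submission
  imports Defs
begin

section \<open>Tangent inequality and integrals of powers\<close>

text \<open>Dividing by \<open>x powr p\<close> reduces this to the tangent at 1, that is, to
  Bernoulli's inequality for \<open>z = y / x\<close>. Convexity is used on the open half-line, so
  \<open>z = 0\<close> is checked separately; for \<open>x = 0\<close> the left side vanishes
  because every \<open>powr\<close> of 0 is 0.\<close>

lemma powr_above_tangent:
  fixes p x y :: real
  assumes "p > 1" "x \<ge> 0" "y \<ge> 0"
  shows "x powr p + p * x powr (p - 1) * (y - x) \<le> y powr p"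
proof (cases "x = 0")
  case True
  then show ?thesis by simp
next
  case False
  with assms have x: "x > 0" by simp
  define z where "z = y / x"
  have z: "z \<ge> 0" using x assms by (simp add: z_def)
  have "1 + p * (z - 1) \<le> z powr p"
  proof (cases "z = 0")
    case True
    then show ?thesis using assms by simp
  next
    case False
    have "(\<lambda>t. t powr p) z - (\<lambda>t. t powr p) 1 \<ge> (p * 1 powr (p - 1)) * (z - 1)"
    proof (rule convex_on_imp_above_tangent[OF powr_convex])
      show "((\<lambda>t. t powr p) has_real_derivative p * 1 powr (p - 1)) (at 1 within {0<..})"
        by (auto intro!: derivative_eq_intros)
    qed (use False z assms in \<open>auto simp: interior_open connected_Ioi\<close>)
    then show ?thesis by simp
  qed
  then have "x powr p * (1 + p * (z - 1)) \<le> x powr p * z powr p"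
    by (intro mult_left_mono) auto
  moreover have "x powr p * z powr p = y powr p"
    using x z by (simp add: z_def flip: powr_mult)
  moreover have "x powr p = x powr (p - 1) * x"
    using x by (simp add: powr_diff)
  moreover have "x * (z - 1) = y - x" using x by (simp add: z_def field_simps)
  moreover have "x powr (p - 1) * x * (1 + p * (z - 1)) = x powr (p - 1) * x + p * x powr (p - 1) * (x * (z - 1))"
    by (simp add: algebra_simps)
  ultimately show ?thesis by simp
qed

text \<open>The nonnegative form serves \<open>hardy_functional\<close>, the Bochner form the
  integrals in \<open>admissible\<close>.\<close>

lemma powr_has_bochner_integral:
  fixes s c :: real
  assumes "s > -1" "c \<ge> 0"
  shows "has_bochner_integral lborel (\<lambda>x. indicator {0<..c} x *\<^sub>R (x powr s)) (c powr (s+1) / (s+1))"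
    and "(\<integral>\<^sup>+x\<in>{0<..c}. ennreal (x powr s) \<partial>lborel) = ennreal (c powr (s+1) / (s+1))"
proof -
  have "((\<lambda>x. x powr s) has_integral (c powr (s+1) / (s+1))) {0<..c}"
    using has_integral_powr_from_0[OF assms]
    by (rule has_integral_spike_set_eq[THEN iffD1, rotated -1])
       (auto intro: negligible_subset[of "{0}"])
  then show *: "(\<integral>\<^sup>+x\<in>{0<..c}. ennreal (x powr s) \<partial>lborel) = ennreal (c powr (s+1) / (s+1))"
    by (intro nn_integral_has_integral_lebesgue') auto
  show "has_bochner_integral lborel (\<lambda>x. indicator {0<..c} x *\<^sub>R (x powr s)) (c powr (s+1) / (s+1))"
  proof (rule has_bochner_integral_nn_integral)
    show "(\<integral>\<^sup>+x. ennreal (indicator {0<..c} x *\<^sub>R x powr s) \<partial>lborel) = ennreal (c powr (s+1) / (s+1))"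
      unfolding *[symmetric] by (intro nn_integral_cong) (auto simp: indicator_def)
  qed (use assms in auto)
qed

lemma set_lborel_powr:
  fixes s c :: real
  assumes "s > -1" "c \<ge> 0"
  shows "set_integrable lborel {0<..c} (\<lambda>x. x powr s)"
    and "(LINT x:{0<..c}|lborel. x powr s) = c powr (s+1) / (s+1)"
  using powr_has_bochner_integral(1)[OF assms]
  unfolding set_integrable_def set_lebesgue_integral_def
  by (auto simp: has_bochner_integral_iff)

lemma set_lborel_const:
  fixes a b c :: real
  assumes "a \<le> b"
  shows "set_integrable lborel {a<..b} (\<lambda>_. c)" "(LINT x:{a<..b}|lborel. c) = (b - a) * c"
  using assms by (auto simp: set_integrable_def set_integral_const)

lemma set_lborel_split:
  fixes g :: "real \<Rightarrow> real"
  assumes "a \<le> b" "b \<le> c" "set_integrable lborel {a<..b} g" "set_integrable lborel {b<..c} g"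
  shows "set_integrable lborel {a<..c} g"
    and "(LINT x:{a<..c}|lborel. g x) = (LINT x:{a<..b}|lborel. g x) + (LINT x:{b<..c}|lborel. g x)"
proof -
  have e: "{a<..c} = {a<..b} \<union> {b<..c}" using assms by auto
  show "set_integrable lborel {a<..c} g"
    unfolding e using assms by (intro set_integrable_Un) auto
  show "(LINT x:{a<..c}|lborel. g x) = (LINT x:{a<..b}|lborel. g x) + (LINT x:{b<..c}|lborel. g x)"
    unfolding e using assms by (intro set_integral_Un) auto
qed

text \<open>Used with the exponents \<open>s\<close> and \<open>s * p\<close>, this evaluates both
  integral constraints for the extremal profile. The split at \<open>k\<close> separates the power
  from the constant.\<close>

lemma set_lborel_powr_min:
  fixes s k :: real
  assumes "s > -1" "0 < k" "k \<le> 1"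
  shows "set_integrable lborel {0<..1} (\<lambda>x. min x k powr s)"
    and "(LINT x:{0<..1}|lborel. min x k powr s) = k powr s * (k / (s+1) + 1 - k)"
proof -
  have i: "set_integrable lborel {0<..k} (\<lambda>x. min x k powr s)"
    using set_lborel_powr(1)[of s k] assms
    by (subst set_integrable_cong[of _ lborel _ "{0<..k}" _ "\<lambda>x. x powr s"]) auto
  have j: "set_integrable lborel {k<..1} (\<lambda>x. min x k powr s)"
    using set_lborel_const(1)[of k 1 "k powr s"] assms
    by (subst set_integrable_cong[of _ lborel _ "{k<..1}" _ "\<lambda>x. k powr s"]) auto
  show "set_integrable lborel {0<..1} (\<lambda>x. min x k powr s)"
    by (rule set_lborel_split(1)[OF _ _ i j]) (use assms in auto)
  have "(LINT x:{0<..k}|lborel. min x k powr s) = (LINT x:{0<..k}|lborel. x powr s)"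
    by (rule set_lebesgue_integral_cong) auto
  moreover have "(LINT x:{k<..1}|lborel. min x k powr s) = (LINT x:{k<..1}|lborel. k powr s)"
    by (rule set_lebesgue_integral_cong) auto
  ultimately have "(LINT x:{0<..1}|lborel. min x k powr s) = k powr (s+1) / (s+1) + (1 - k) * k powr s"
    using set_lborel_split(2)[OF _ _ i j] set_lborel_powr(2)[of s k] set_lborel_const(2)[of k 1 "k powr s"] assms
    by simp
  also have "k powr (s+1) = k powr s * k" using assms by (simp add: powr_add)
  finally show "(LINT x:{0<..1}|lborel. min x k powr s) = k powr s * (k / (s+1) + 1 - k)"
    by (simp add: algebra_simps)
qed

section \<open>Running averages and the inequality on one interval\<close>

locale admissible_fun =
  fixes p f F :: real and g :: "real \<Rightarrow> real"
  assumes p: "p > 1" and adm: "admissible p f F g"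
begin

definition mass :: "real \<Rightarrow> real" where
  "mass t = (LINT u:{0<..t}|lborel. g u)"

text \<open>The Hardy average, called Tg in the overview. Division by zero gives
  \<open>avg 0 = 0\<close>; in \<open>avg_powr_step\<close> this value is only used multiplied by
  0.\<close>

definition avg :: "real \<Rightarrow> real" where
  "avg t = (1 / t) * mass t"

lemma g_nonneg: "0 < x \<Longrightarrow> x \<le> 1 \<Longrightarrow> 0 \<le> g x"
  and g_antimono: "0 < x \<Longrightarrow> x \<le> y \<Longrightarrow> y \<le> 1 \<Longrightarrow> g y \<le> g x"
  using adm by (auto simp: admissible_def)

lemma g_integrable: "0 \<le> a \<Longrightarrow> b \<le> 1 \<Longrightarrow> set_integrable lborel {a<..b} g"
  and g_powr_integrable: "0 \<le> a \<Longrightarrow> b \<le> 1 \<Longrightarrow> set_integrable lborel {a<..b} (\<lambda>x. g x powr p)"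
  using adm by (auto simp: admissible_def elim!: set_integrable_subset)

lemma mass_diff:
  assumes "0 \<le> a" "a \<le> b" "b \<le> 1"
  shows "(LINT u:{a<..b}|lborel. g u) = mass b - mass a"
  using set_lborel_split(2)[of 0 a b g] g_integrable[of 0 a] g_integrable[of a b] assms
  by (simp add: mass_def)

lemma mass_0 [simp]: "mass 0 = 0"
  by (simp add: mass_def set_lebesgue_integral_def)

lemma mass_eq_avg: "0 \<le> t \<Longrightarrow> mass t = t * avg t"
  by (cases "t = 0") (auto simp: avg_def)

lemma mass_nonneg: "t \<le> 1 \<Longrightarrow> 0 \<le> mass t"
  unfolding mass_def set_lebesgue_integral_def
  by (intro Bochner_Integration.integral_nonneg) (auto simp: indicator_def g_nonneg)

lemma avg_nonneg: "0 \<le> t \<Longrightarrow> t \<le> 1 \<Longrightarrow> 0 \<le> avg t"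
  by (simp add: avg_def mass_nonneg)

text \<open>The number \<open>g a\<close> separates the two pieces: \<open>g\<close> is at least
  \<open>g a\<close> on \<open>(0, a]\<close> and at most \<open>g a\<close> on
  \<open>(a, b]\<close>, so enlarging the interval can only lower the mean.\<close>

lemma avg_antimono:
  assumes "0 < a" "a \<le> b" "b \<le> 1"
  shows "avg b \<le> avg a"
proof -
  have "(LINT u:{0<..a}|lborel. g a) \<le> mass a"
    unfolding mass_def using assms
    by (intro set_integral_mono g_integrable set_lborel_const g_antimono) auto
  then have 1: "a * g a \<le> mass a"
    using set_lborel_const(2)[of 0 a "g a"] assms by simp
  have "(LINT u:{a<..b}|lborel. g u) \<le> (LINT u:{a<..b}|lborel. g a)"
    using assms by (intro set_integral_mono g_integrable set_lborel_const g_antimono) auto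
  then have "mass b - mass a \<le> (b - a) * g a"
    using set_lborel_const(2)[of a b "g a"] mass_diff[of a b] assms by simp
  then have "a * (mass b - mass a) \<le> a * ((b - a) * g a)"
    using assms by (intro mult_left_mono) auto
  also have "\<dots> = (b - a) * (a * g a)" by simp
  also have "\<dots> \<le> (b - a) * mass a"
    using assms 1 by (intro mult_left_mono) auto
  finally have "a * mass b \<le> b * mass a" by (simp add: algebra_simps)
  then show ?thesis using assms by (simp add: avg_def field_simps)
qed

text \<open>A discrete form of the differential inequality for \<open>t * avg t powr p\<close>; no differentiability
  of \<open>mass\<close> is needed because only the tangent inequality enters.\<close>
lemma avg_powr_step:
  assumes "0 \<le> a" "a \<le> b" "0 < b" "b \<le> 1" "w > 1"
  shows "b * avg b powr p - a * avg a powr p + (p - 1) * (1 - 1 / w) * ((b - a) * avg b powr p)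
          \<le> w powr (p - 1) * (LINT u:{a<..b}|lborel. g u powr p)"
proof -
  define h where "h = avg b"
  have h: "h \<ge> 0" using avg_nonneg assms by (simp add: h_def)
  have hp: "h powr (p - 1) * h = h powr p"
    using h by (cases "h = 0") (auto simp: powr_diff)
  have wp: "w powr p / w = w powr (p - 1)" using assms by (simp add: powr_diff)
  \<comment> \<open>The tangent at \<open>h = avg b\<close> bounds the earlier average from below.
    After multiplication by \<open>a\<close>, the increment \<open>mass b - mass a\<close> takes the
    place of a derivative of \<open>mass\<close>.\<close>
  have "h powr p + p * h powr (p - 1) * (avg a - h) \<le> avg a powr p"
    using p h assms by (intro powr_above_tangent avg_nonneg) auto
  then have "a * (h powr p + p * h powr (p - 1) * (avg a - h)) \<le> a * avg a powr p"
    using assms by (intro mult_left_mono) auto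
  moreover have "a * (h powr p + p * h powr (p - 1) * (avg a - h))
      = a * h powr p + p * h powr (p - 1) * (a * avg a - a * h)"
    by (simp add: algebra_simps)
  moreover have "a * avg a = b * h - (mass b - mass a)"
    using mass_eq_avg[of a] mass_eq_avg[of b] assms by (simp add: h_def)
  moreover have "p * h powr (p - 1) * (b * h - (mass b - mass a) - a * h)
      = p * (b - a) * (h powr (p - 1) * h) - p * h powr (p - 1) * (mass b - mass a)"
    by (simp add: algebra_simps)
  ultimately have 1: "b * h powr p - a * avg a powr p
      \<le> p * h powr (p - 1) * (mass b - mass a) - (p - 1) * (b - a) * h powr p"
    unfolding hp by (simp add: algebra_simps)
  \<comment> \<open>Young's inequality as a tangent inequality: the tangent at \<open>h\<close> is
    evaluated at \<open>w * g u\<close> and the result divided by \<open>w\<close>. Equality holds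
    for \<open>h = w * g u\<close>, the relation between average and value in the extremal
    function.\<close>
  have young: "p * h powr (p - 1) * g u \<le> (p - 1) / w * h powr p + w powr (p - 1) * g u powr p"
    if u: "u \<in> {a<..b}" for u
  proof -
    have gu: "g u \<ge> 0" using g_nonneg u assms by auto
    have "h powr p + p * h powr (p - 1) * (w * g u - h) \<le> (w * g u) powr p"
      using p h gu assms by (intro powr_above_tangent) auto
    also have "(w * g u) powr p = w powr p * g u powr p"
      using assms gu by (simp add: powr_mult)
    also have "p * h powr (p - 1) * (w * g u - h) = w * (p * h powr (p - 1) * g u) - p * (h powr (p - 1) * h)"
      by (simp add: algebra_simps)
    finally have "w * (p * h powr (p - 1) * g u) \<le> (p - 1) * h powr p + w powr p * g u powr p"
      unfolding hp by (simp add: algebra_simps)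
    then have "p * h powr (p - 1) * g u \<le> ((p - 1) * h powr p + w powr p * g u powr p) / w"
      using assms by (simp add: pos_le_divide_eq mult.commute)
    also have "\<dots> = (p - 1) / w * h powr p + w powr (p - 1) * g u powr p"
      unfolding wp[symmetric] by (simp add: add_divide_distrib)
    finally show ?thesis .
  qed
  have "p * h powr (p - 1) * (mass b - mass a) = (LINT u:{a<..b}|lborel. p * h powr (p - 1) * g u)"
    using mass_diff[of a b] assms by simp
  also have "\<dots> \<le> (LINT u:{a<..b}|lborel. (p - 1) / w * h powr p + w powr (p - 1) * g u powr p)"
    by (rule set_integral_mono[OF _ _ young])
       (use assms in \<open>auto intro!: set_integral_add set_lborel_const set_integrable_mult_right g_integrable g_powr_integrable\<close>)
  also have "\<dots> = (LINT u:{a<..b}|lborel. (p - 1) / w * h powr p) + (LINT u:{a<..b}|lborel. w powr (p - 1) * g u powr p)"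
    using assms by (intro set_integral_add set_lborel_const set_integrable_mult_right g_powr_integrable) auto
  also have "\<dots> = (b - a) * ((p - 1) / w * h powr p) + w powr (p - 1) * (LINT u:{a<..b}|lborel. g u powr p)"
    using set_lborel_const(2)[of a b] assms by simp
  finally have "p * h powr (p - 1) * (mass b - mass a)
      \<le> (b - a) * ((p - 1) / w * h powr p) + w powr (p - 1) * (LINT u:{a<..b}|lborel. g u powr p)" .
  moreover have "(p - 1) * (1 - 1 / w) * ((b - a) * h powr p)
      = (p - 1) * (b - a) * h powr p - (b - a) * ((p - 1) / w * h powr p)"
    by (simp add: algebra_simps diff_divide_distrib)
  moreover have "X + E \<le> V" if "P \<le> R + V" "E = Q - R" "X \<le> P - Q" for X E V P R Q :: real
    using that by simp
  ultimately show ?thesis using 1 unfolding h_def[symmetric] by blast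
qed

section \<open>From grid sums to the integral over (0, k]\<close>

text \<open>The boundary terms of \<open>avg_powr_step\<close> telescope along the grid
  \<open>j * d\<close>, and the one at 0 vanishes. The accumulated sum samples \<open>avg\<close> at
  right endpoints.\<close>

lemma avg_powr_sum:
  fixes n :: nat
  assumes "0 < d" "real n * d \<le> 1" "w > 1"
  shows "real n * d * avg (real n * d) powr p + (p - 1) * (1 - 1 / w) * (\<Sum>j=1..n. d * avg (real j * d) powr p)
          \<le> w powr (p - 1) * (LINT u:{0<..real n * d}|lborel. g u powr p)"
  using assms(2)
proof (induction n)
  case 0
  then show ?case by (simp add: set_lebesgue_integral_def)
next
  case (Suc n)
  define a b where "a = real n * d" and "b = real (Suc n) * d"
  have ab: "0 \<le> a" "a \<le> b" "0 < b" "b \<le> 1" "b - a = d"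
    using Suc assms by (auto simp: a_def b_def algebra_simps intro: add_pos_nonneg)
  have "(LINT u:{0<..b}|lborel. g u powr p) = (LINT u:{0<..a}|lborel. g u powr p) + (LINT u:{a<..b}|lborel. g u powr p)"
    by (rule set_lborel_split(2)) (use ab in \<open>auto intro!: g_powr_integrable\<close>)
  moreover have "a * avg a powr p + (p - 1) * (1 - 1 / w) * (\<Sum>j=1..n. d * avg (real j * d) powr p)
          \<le> w powr (p - 1) * (LINT u:{0<..a}|lborel. g u powr p)"
    using Suc.IH ab unfolding a_def[symmetric] by simp
  moreover have sum: "(\<Sum>j=1..Suc n. d * avg (real j * d) powr p) = (\<Sum>j=1..n. d * avg (real j * d) powr p) + d * avg b powr p"
    by (simp add: b_def del: of_nat_Suc)
  ultimately show ?case
    using avg_powr_step[OF ab(1-4) assms(3)] unfolding sum b_def[symmetric] ab(5)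
    by (simp add: distrib_left)
qed

text \<open>Monotone functions are Borel; the sign change turns the decreasing average into an
  increasing function.\<close>

lemma avg_powr_measurable:
  assumes "0 \<le> a" "b \<le> 1"
  shows "(\<lambda>t. ennreal (avg t powr p) * indicator {a<..b} t) \<in> borel_measurable lborel"
proof -
  have "mono_on {a<..b} (\<lambda>t. - avg t)"
    using avg_antimono assms by (auto simp: mono_on_def)
  then have "(\<lambda>t. - avg t) \<in> borel_measurable (restrict_space borel {a<..b})"
    by (rule borel_measurable_mono_on_fnc)
  then have "(\<lambda>t. - (- avg t)) \<in> borel_measurable (restrict_space borel {a<..b})"
    by (rule borel_measurable_uminus)
  then have "(\<lambda>t. ennreal (avg t powr p)) \<in> borel_measurable (restrict_space borel {a<..b})"
    by simp
  then show ?thesis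
    by (subst (asm) borel_measurable_restrict_space_iff_ennreal) auto
qed

text \<open>On each cell the decreasing \<open>avg\<close> is at most its value at the left
  endpoint. The cell \<open>(0, d]\<close> is left out, since \<open>avg\<close> may blow up at 0;
  the left endpoints of the other cells are among the right endpoints sampled in
  \<open>avg_powr_sum\<close>.\<close>

lemma nn_integral_avg_powr_le_sum:
  fixes n :: nat
  assumes "0 < d" "real n * d \<le> 1"
  shows "(\<integral>\<^sup>+t\<in>{d<..real n * d}. ennreal (avg t powr p) \<partial>lborel)
          \<le> ennreal (\<Sum>j=1..<n. d * avg (real j * d) powr p)"
  using assms(2)
proof (induction n)
  case 0
  have "{d<..0} = {}" using assms by auto
  then show ?case by simp
next
  case (Suc n)
  define a b where "a = real n * d" and "b = real (Suc n) * d"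
  have ab: "0 \<le> a" "a \<le> b" "0 < b" "b \<le> 1" "b - a = d"
    using Suc assms by (auto simp: a_def b_def algebra_simps intro: add_pos_nonneg)
  show ?case
  proof (cases "n = 0")
    case True
    then show ?thesis by simp
  next
    case False
    have da: "d \<le> a" using assms False by (simp add: a_def)
    have a0: "a > 0" using da assms by simp
    have "(\<integral>\<^sup>+t\<in>{d<..b}. ennreal (avg t powr p) \<partial>lborel)
        \<le> (\<integral>\<^sup>+t. ennreal (avg t powr p) * indicator {d<..a} t + ennreal (avg a powr p) * indicator {a<..b} t \<partial>lborel)"
    proof (rule nn_integral_mono)
      fix t
      have "avg t powr p \<le> avg a powr p" if "t \<in> {a<..b}"
        using that avg_antimono[of a t] avg_nonneg[of t] ab a0 p by (intro powr_mono2) auto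
      then show "ennreal (avg t powr p) * indicator {d<..b} t
        \<le> ennreal (avg t powr p) * indicator {d<..a} t + ennreal (avg a powr p) * indicator {a<..b} t"
        using ennreal_leI by (auto simp: indicator_def)
    qed
    also have "\<dots> = (\<integral>\<^sup>+t. ennreal (avg t powr p) * indicator {d<..a} t \<partial>lborel)
         + (\<integral>\<^sup>+t. ennreal (avg a powr p) * indicator {a<..b} t \<partial>lborel)"
    using ab assms by (intro nn_integral_add avg_powr_measurable) auto
    also have "(\<integral>\<^sup>+t. ennreal (avg a powr p) * indicator {a<..b} t \<partial>lborel) = ennreal (avg a powr p) * ennreal d"
      using ab by (simp add: nn_integral_cmult_indicator)
    also have "\<dots> = ennreal (d * avg (real n * d) powr p)"
      using assms by (simp add: a_def mult.commute flip: ennreal_mult')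
    finally have "(\<integral>\<^sup>+t\<in>{d<..b}. ennreal (avg t powr p) \<partial>lborel)
      \<le> (\<integral>\<^sup>+t\<in>{d<..a}. ennreal (avg t powr p) \<partial>lborel) + ennreal (d * avg (real n * d) powr p)" .
    also have "\<dots> \<le> ennreal (\<Sum>j=1..<n. d * avg (real j * d) powr p) + ennreal (d * avg (real n * d) powr p)"
      using Suc.IH ab by (intro add_right_mono) (simp add: a_def)
    also have "\<dots> = ennreal (\<Sum>j=1..<Suc n. d * avg (real j * d) powr p)"
      using False assms by (simp add: ennreal_plus[symmetric] sum_nonneg del: ennreal_plus)
    finally show ?thesis by (simp add: b_def)
  qed
qed

lemma hardy_functional_avg:
  "hardy_functional p k g = (\<integral>\<^sup>+t. ennreal (avg t powr p) * indicator {0<..k} t \<partial>lborel)"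
  by (simp add: hardy_functional_def avg_def mass_def)

text \<open>On a grid of mesh \<open>k / real (Suc n)\<close> the integral away from the first cell
  is below a grid sum that \<open>avg_powr_sum\<close> controls. The bound does not depend on
  \<open>n\<close>, so monotone convergence extends it to all of \<open>(0, k]\<close>; finiteness
  of the functional comes out as well.\<close>

lemma hardy_functional_le_local:
  assumes "0 < k" "k \<le> 1" "w > 1"
  shows "hardy_functional p k g \<le> ennreal ((w powr (p - 1) * (LINT u:{0<..k}|lborel. g u powr p) - k * avg k powr p)
            / ((p - 1) * (1 - 1 / w)))"
    (is "_ \<le> ennreal ?B")
proof -
  define u where "u n t = ennreal (avg t powr p) * indicator {k / real (Suc n)<..k} t" for n t
  have um: "u n \<in> borel_measurable lborel" for n
    unfolding u_def using assms by (intro avg_powr_measurable) auto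
  have C: "(p - 1) * (1 - 1 / w) > 0" using p assms by simp
  have bound: "(\<integral>\<^sup>+t. u n t \<partial>lborel) \<le> ennreal ?B" for n
  proof -
    define d where "d = k / real (Suc n)"
    have d: "0 < d" and nd: "real (Suc n) * d = k"
      using assms by (auto simp: d_def simp del: of_nat_Suc)
    have "(\<integral>\<^sup>+t. u n t \<partial>lborel) = (\<integral>\<^sup>+t\<in>{d<..real (Suc n) * d}. ennreal (avg t powr p) \<partial>lborel)"
      unfolding nd by (simp add: u_def d_def)
    also have "\<dots> \<le> ennreal (\<Sum>j=1..<Suc n. d * avg (real j * d) powr p)"
      using d nd assms by (intro nn_integral_avg_powr_le_sum) auto
    \<comment> \<open>The added term belongs to the grid point \<open>k\<close>; it turns the
      left-endpoint sum into the right-endpoint sum of \<open>avg_powr_sum\<close>.\<close>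
    also have "\<dots> \<le> ennreal (\<Sum>j=1..Suc n. d * avg (real j * d) powr p)"
      using d by (intro ennreal_leI sum_mono2) auto
    also have "\<dots> \<le> ennreal ?B"
    proof (rule ennreal_leI)
      show "(\<Sum>j=1..Suc n. d * avg (real j * d) powr p) \<le> ?B"
        using avg_powr_sum[OF d _ assms(3), of "Suc n"] C assms
        unfolding nd by (simp add: pos_le_divide_eq mult.commute)
    qed
    finally show ?thesis .
  qed
  have "(\<lambda>n. \<integral>\<^sup>+t. u n t \<partial>lborel) \<longlonglongrightarrow> (\<integral>\<^sup>+t. ennreal (avg t powr p) * indicator {0<..k} t \<partial>lborel)"
  proof (rule nn_integral_LIMSEQ[OF _ um])
    show "incseq u"
    proof (intro incseq_SucI le_funI)
      fix n t
      have "k / real (Suc (Suc n)) \<le> k / real (Suc n)"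
        using assms by (intro divide_left_mono) auto
      then show "u n t \<le> u (Suc n) t" by (auto simp: u_def indicator_def)
    qed
    show "(\<lambda>n. u n t) \<longlonglongrightarrow> ennreal (avg t powr p) * indicator {0<..k} t" for t
    proof (cases "t \<in> {0<..k}")
      case True
      have "(\<lambda>n. k / real (Suc n)) \<longlonglongrightarrow> 0"
        by (rule LIMSEQ_Suc[OF lim_const_over_n])
      then have "\<forall>\<^sub>F n in sequentially. k / real (Suc n) < t"
        using True by (intro order_tendstoD) auto
      then have "\<forall>\<^sub>F n in sequentially. u n t = ennreal (avg t powr p) * indicator {0<..k} t"
        by eventually_elim (use True in \<open>auto simp: u_def\<close>)
      then show ?thesis by (rule tendsto_eventually)
    next
      case False
      have "0 \<le> k / real (Suc n)" for n using assms by simp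
      then have "u n t = 0" for n
        using False by (auto simp: u_def indicator_def dest: le_less_trans)
      then show ?thesis using False by simp
    qed
  qed
  then show ?thesis
    unfolding hardy_functional_avg using bound by (intro LIMSEQ_le_const2) auto
qed

section \<open>Upper bound independent of the competitor\<close>

text \<open>\<open>A\<close> and \<open>w * A\<close> are the value on \<open>(k, 1]\<close> and the
  average over \<open>(0, k]\<close> expected of an extremal function, and the total mass
  \<open>f\<close> determines \<open>A\<close>. Tangents at these two points eliminate
  \<open>avg k\<close> and the part of \<open>g\<close> on \<open>(k, 1]\<close>.\<close>

lemma hardy_functional_le:
  assumes "0 < k" "k \<le> 1" "w > 1" "f \<ge> 0"
  defines "A \<equiv> f / (k * w + 1 - k)"
  shows "hardy_functional p k g \<le> ennreal (w powr (p - 1) * (F - A powr p * (k * w + 1 - k)) / ((p - 1) * (1 - 1 / w)))"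
proof -
  define y T where "y = avg k" and "T = (LINT u:{k<..1}|lborel. g u powr p)"
  have "k * 1 < k * w" using assms by (intro mult_strict_left_mono) auto
  then have D: "k * w + 1 - k > 0" by simp
  have A: "A \<ge> 0" using D assms by simp
  have Af: "A * (k * w + 1 - k) = f" using D by (simp add: A_def)
  have y: "y \<ge> 0" using avg_nonneg assms by (simp add: y_def)
  have f: "mass 1 = f" using adm by (simp add: mass_def admissible_def)
  have "(LINT u:{k<..1}|lborel. A powr p + p * A powr (p - 1) * (g u - A)) \<le> T"
    unfolding T_def
    by (rule set_integral_mono)
       (use assms p A in \<open>auto intro!: set_integral_add set_integral_diff set_lborel_const set_integrable_mult_right
          g_integrable g_powr_integrable powr_above_tangent g_nonneg\<close>)
  also have "(LINT u:{k<..1}|lborel. A powr p + p * A powr (p - 1) * (g u - A))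
      = (LINT u:{k<..1}|lborel. (A powr p - p * A powr (p - 1) * A) + p * A powr (p - 1) * g u)"
    by (simp add: algebra_simps)
  also have "\<dots> = (LINT u:{k<..1}|lborel. (A powr p - p * A powr (p - 1) * A)) + (LINT u:{k<..1}|lborel. p * A powr (p - 1) * g u)"
    using assms by (intro set_integral_add set_lborel_const set_integrable_mult_right g_integrable) auto
  also have "\<dots> = (1 - k) * (A powr p - p * A powr (p - 1) * A) + p * A powr (p - 1) * (f - k * y)"
    using assms set_lborel_const(2)[of k 1] mass_diff[of k 1] mass_eq_avg[of k] f by (simp add: y_def)
  finally have T: "(1 - k) * (A powr p - p * A powr (p - 1) * A) + p * A powr (p - 1) * (f - k * y) \<le> T" .
  \<comment> \<open>The slope at \<open>w * A\<close> is \<open>w powr (p - 1)\<close> times the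
    slope at \<open>A\<close>. Hence \<open>y\<close> cancels when this bound, weighted by
    \<open>k\<close>, is added to \<open>w powr (p - 1)\<close> times the bound for
    \<open>T\<close>.\<close>
  have "(w * A) powr p + p * (w * A) powr (p - 1) * (y - w * A) \<le> y powr p"
    using p A y assms(3) by (intro powr_above_tangent mult_nonneg_nonneg) auto
  moreover have "(w * A) powr p = w powr (p - 1) * (w * A powr p)"
    using assms(3) A by (simp add: powr_mult powr_diff)
  moreover have "(w * A) powr (p - 1) = w powr (p - 1) * A powr (p - 1)"
    using assms(3) A by (simp add: powr_mult)
  ultimately have "w powr (p - 1) * (w * A powr p + p * A powr (p - 1) * (y - w * A)) \<le> y powr p"
    by (simp add: algebra_simps)
  then have "k * (w powr (p - 1) * (w * A powr p + p * A powr (p - 1) * (y - w * A))) \<le> k * y powr p"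
    using assms by (intro mult_left_mono) auto
  moreover have "w powr (p - 1) * ((1 - k) * (A powr p - p * A powr (p - 1) * A) + p * A powr (p - 1) * (f - k * y))
      \<le> w powr (p - 1) * T"
    using T by (intro mult_left_mono) auto
  moreover have "k * (w powr (p - 1) * (w * A powr p + p * A powr (p - 1) * (y - w * A)))
      + w powr (p - 1) * ((1 - k) * (A powr p - p * A powr (p - 1) * A) + p * A powr (p - 1) * (f - k * y))
      = w powr (p - 1) * (A powr p * (k * w + 1 - k))"
    unfolding Af[symmetric] by (simp add: algebra_simps)
  ultimately have *: "w powr (p - 1) * (A powr p * (k * w + 1 - k)) \<le> w powr (p - 1) * T + k * y powr p"
    by linarith
  have "F = (LINT u:{0<..k}|lborel. g u powr p) + T"
    using adm set_lborel_split(2)[of 0 k 1 "\<lambda>x. g x powr p"] g_powr_integrable[of 0 k] g_powr_integrable[of k 1] assms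
    by (simp add: T_def admissible_def)
  then have "w powr (p - 1) * (LINT u:{0<..k}|lborel. g u powr p) - k * avg k powr p
      \<le> w powr (p - 1) * (F - A powr p * (k * w + 1 - k))"
    using * by (simp add: y_def algebra_simps)
  then show ?thesis
    using hardy_functional_le_local[OF assms(1-3)] p assms(3)
    by (elim order_trans) (intro ennreal_leI divide_right_mono; simp)
qed

end

section \<open>Solving for the exponent\<close>

text \<open>The equation prescribes the ratio \<open>M\<close> between the integral of the p-th
  power of \<open>min x k powr s\<close> and the p-th power of its integral, after cancelling
  \<open>k powr (s * p)\<close>. At \<open>s = 0\<close> the sides are 1 and \<open>M\<close>; as
  \<open>s * p\<close> decreases to -1 the left side is unbounded and the right side stays bounded,
  so the intermediate value theorem applies.\<close>

lemma exists_exponent: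
  fixes p k M :: real
  assumes "p > 1" "0 < k" "k \<le> 1" "M \<ge> 1"
  obtains s where "- 1 < s * p" "s \<le> 0" "k / (s * p + 1) + 1 - k = M * (k / (s + 1) + 1 - k) powr p"
proof -
  \<comment> \<open>\<open>D\<close> will bound the p-th power at the left end \<open>r\<close>, and
    \<open>r\<close> is chosen so that \<open>k / (r * p + 1) = k + M * D\<close>, which makes
    \<open>\<phi> r\<close> nonnegative.\<close>
  define D where "D = (p / (p - 1) + 1) powr p"
  define r where "r = (k / (k + M * D) - 1) / p"
  define \<phi> where "\<phi> s = k / (s * p + 1) + 1 - k - M * (k / (s + 1) + 1 - k) powr p" for s
  have D: "D \<ge> 0" by (simp add: D_def)
  have MD: "k + M * D > 0" "M * D \<ge> 0" using D assms by (auto intro: add_pos_nonneg)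
  have rp: "r * p + 1 = k / (k + M * D)" using assms by (simp add: r_def)
  have rp0: "- 1 < r * p" using rp MD assms by (smt (verit) divide_pos_pos)
  have "k / (k + M * D) \<le> 1" using MD assms by simp
  then have r0: "r \<le> 0" using assms by (simp add: r_def divide_nonpos_pos)
  have base: "s + 1 \<ge> (p - 1) / p" if "- 1 < s * p" for s
  proof -
    have "- 1 / p < s" using that assms pos_divide_less_eq[of p "- 1" s] by simp
    then show ?thesis using assms by (simp add: diff_divide_distrib)
  qed
  have base0: "s + 1 > 0" if "- 1 < s * p" for s
    using base[OF that] assms by (smt (verit) divide_pos_pos)
  have mono: "- 1 < s * p" if "r \<le> s" for s
  proof -
    have "r * p \<le> s * p" using that assms by (intro mult_right_mono) auto
    then show ?thesis using rp0 by simp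
  qed
  have "k / (r + 1) \<le> 1 / (r + 1)" using base0[OF rp0] assms by (simp add: divide_right_mono)
  also have "\<dots> \<le> 1 / ((p - 1) / p)" using base[OF rp0] base0[OF rp0] assms by (intro divide_left_mono) auto
  finally have "k / (r + 1) \<le> p / (p - 1)" by simp
  moreover have "0 \<le> k / (r + 1)" using base0[OF rp0] assms by simp
  ultimately have "(k / (r + 1) + 1 - k) powr p \<le> D"
    unfolding D_def using assms by (intro powr_mono2) auto
  then have "M * (k / (r + 1) + 1 - k) powr p \<le> M * D" using assms by (intro mult_left_mono) auto
  moreover have "k / (r * p + 1) = k + M * D" unfolding rp using MD assms by simp
  ultimately have 1: "0 \<le> \<phi> r" by (simp add: \<phi>_def)
  have 2: "\<phi> 0 \<le> 0" using assms by (simp add: \<phi>_def)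
  have "continuous_on {r..0} \<phi>"
    unfolding \<phi>_def
  proof (intro continuous_intros ballI)
    fix s assume "s \<in> {r..0}"
    then have s: "s * p > - 1" "s + 1 > 0" using mono base0 by auto
    show "s * p + 1 \<noteq> 0" "s + 1 \<noteq> 0" using s by auto
    have "k / (s + 1) > 0" using s assms by simp
    then show "k / (s + 1) + 1 - k \<noteq> 0" using assms by simp
  qed
  from IVT2'[OF 2 1 r0 this] obtain s where "r \<le> s" "s \<le> 0" "\<phi> s = 0" by blast
  then show ?thesis using that[of s] mono by (simp add: \<phi>_def)
qed

section \<open>The extremal function and its optimality\<close>

theorem theorem1p2:
  fixes p f F k :: real
  assumes "p > 1" and "f > 0" and "f powr p \<le> F" and "0 < k" and "k \<le> 1"
  shows "\<exists>g. admissible p f F g \<and> continuous_on {0<..1} g \<and>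
             hardy_functional p k g = S_sup p k f F"
proof -
  define M where "M = F / f powr p"
  have M: "M \<ge> 1" "F = M * f powr p" using assms by (auto simp: M_def)
  obtain s where s: "- 1 < s * p" "s \<le> 0" and
    eq: "k / (s * p + 1) + 1 - k = M * (k / (s + 1) + 1 - k) powr p"
    using exists_exponent[OF assms(1,4,5) M(1)] by metis
  have "s * p \<le> s * 1" using s assms by (intro mult_left_mono_neg) auto
  then have s1: "- 1 < s" using s by simp
  define w where "w = 1 / (s + 1)"
  define A where "A = f / (k * w + 1 - k)"
  \<comment> \<open>This normalisation makes \<open>g\<close> equal to \<open>A\<close> on
    \<open>[k, 1]\<close>, while \<open>A\<close> is fixed by the total mass
    \<open>f\<close>.\<close>
  define B where "B = A * k powr (- s)"
  define g where "g x = B * min x k powr s" for x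
  have w: "w \<ge> 1" using s s1 by (simp add: w_def)
  have "k * 1 \<le> k * w" using w assms by (intro mult_left_mono) auto
  then have D: "k * w + 1 - k > 0" by simp
  have A: "A > 0" "A * (k * w + 1 - k) = f" using D assms by (auto simp: A_def)
  have B: "B > 0" "B * k powr s = A" using A assms by (auto simp: B_def powr_minus)
  have kw: "k / (s + 1) = k * w" by (simp add: w_def)
  have Bp: "B powr p * k powr (s * p) = A powr p"
    using B(1) assms by (simp add: B(2)[symmetric] powr_mult powr_powr)
  \<comment> \<open>With the mass already equal to \<open>f\<close>, the exponent equation is
    exactly the constraint on the integral of \<open>g x powr p\<close>.\<close>
  have F: "F = A powr p * (k / (s * p + 1) + 1 - k)"
    unfolding eq kw M(2) A(2)[symmetric] using A(1) D by (simp add: powr_mult)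
  have g_powr: "g x powr p = B powr p * min x k powr (s * p)" for x
    using B by (simp add: g_def powr_mult powr_powr)
  have adm: "admissible p f F g"
    unfolding admissible_def
  proof (intro conjI ballI impI)
    show "0 \<le> g x" for x using B by (simp add: g_def)
    show "g y \<le> g x" if "x \<in> {0<..1}" "y \<in> {0<..1}" "x \<le> y" for x y
      unfolding g_def using that B s assms by (intro mult_left_mono powr_mono2') auto
    show "set_integrable lborel {0<..1} g"
      unfolding g_def using set_lborel_powr_min(1)[of s k] s1 assms by simp
    show "set_integrable lborel {0<..1} (\<lambda>x. g x powr p)"
      unfolding g_powr using set_lborel_powr_min(1)[of "s * p" k] s assms by simp
    have "(LINT x:{0<..1}|lborel. g x) = B * k powr s * (k * w + 1 - k)"
      unfolding g_def using set_lborel_powr_min(2)[of s k] s1 assms kw by simp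
    then show "(LINT x:{0<..1}|lborel. g x) = f" using B A by simp
    have "(LINT x:{0<..1}|lborel. g x powr p) = B powr p * k powr (s * p) * (k / (s * p + 1) + 1 - k)"
      unfolding g_powr using set_lborel_powr_min(2)[of "s * p" k] s assms by simp
    then show "(LINT x:{0<..1}|lborel. g x powr p) = F" unfolding Bp F .
  qed
  have cont: "continuous_on {0<..1} g"
    unfolding g_def using assms by (intro continuous_intros) auto
  \<comment> \<open>On \<open>(0, k]\<close> the average is \<open>w * g t\<close>, the equality
    case of Young's inequality.\<close>
  have avg: "(1 / t) * (LINT u:{0<..t}|lborel. g u) = B * w * t powr s" if t: "t \<in> {0<..k}" for t
  proof -
    have "(LINT u:{0<..t}|lborel. g u) = (LINT u:{0<..t}|lborel. B * u powr s)"
      using t by (intro set_lebesgue_integral_cong) (auto simp: g_def)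
    also have "\<dots> = B * (t powr (s + 1) / (s + 1))"
      using set_lborel_powr(2)[of s t] s1 t by simp
    finally show ?thesis using t by (simp add: powr_add w_def)
  qed
  have "hardy_functional p k g = (\<integral>\<^sup>+t. ennreal ((B * w) powr p) * (ennreal (t powr (s * p)) * indicator {0<..k} t) \<partial>lborel)"
    unfolding hardy_functional_def
  proof (intro nn_integral_cong)
    fix t
    have "(B * w * t powr s) powr p = (B * w) powr p * t powr (s * p)" if "t \<in> {0<..k}"
      using that B w by (simp add: powr_mult powr_powr)
    then show "ennreal ((1 / t * (LINT u:{0<..t}|lborel. g u)) powr p) * indicator {0<..k} t
        = ennreal ((B * w) powr p) * (ennreal (t powr (s * p)) * indicator {0<..k} t)"
      using avg[of t] by (auto simp: indicator_def ennreal_mult')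
  qed
  also have "\<dots> = ennreal ((B * w) powr p) * ennreal (k powr (s * p + 1) / (s * p + 1))"
    using powr_has_bochner_integral(2)[of "s * p" k] s assms by (subst nn_integral_cmult) auto
  also have "\<dots> = ennreal ((B * w) powr p * (k powr (s * p + 1) / (s * p + 1)))"
    by (rule ennreal_mult'[symmetric]) simp
  also have "(B * w) powr p * (k powr (s * p + 1) / (s * p + 1)) = w powr p * (B powr p * k powr (s * p)) * k / (s * p + 1)"
    using B w assms by (simp add: powr_mult powr_add)
  finally have hardy_g: "hardy_functional p k g = ennreal (w powr p * A powr p * k / (s * p + 1))"
    unfolding Bp .
  have "hardy_functional p k u \<le> ennreal (w powr p * A powr p * k / (s * p + 1))" if "admissible p f F u" for u
  proof -
    interpret admissible_fun p f F u using that assms by unfold_locales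
    show ?thesis
    \<comment> \<open>The general bound divides by \<open>1 - 1 / w = - s\<close>, so the constant
      extremal function needs a limit argument.\<close>
    proof (cases "s = 0")
      case False
      then have s0: "s < 0" using s by simp
      have w1: "w > 1" using s0 s1 by (simp add: w_def)
      \<comment> \<open>This exposes a factor \<open>(- s) * (p - 1)\<close> in the numerator of the
        bound, which cancels against the denominator and leaves the value attained by
        \<open>g\<close>.\<close>
      have "1 / (s * p + 1) - w = (- s) * (p - 1) * w / (s * p + 1)"
        using s s1 by (simp add: w_def field_simps)
      moreover have "F - A powr p * (k * w + 1 - k) = A powr p * k * (1 / (s * p + 1) - w)"
        unfolding F by (simp add: algebra_simps)
      ultimately have "F - A powr p * (k * w + 1 - k) = A powr p * k * ((- s) * (p - 1) * w / (s * p + 1))"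
        by simp
      moreover have "1 - 1 / w = - s" by (simp add: w_def)
      moreover have "w powr p = w powr (p - 1) * w" using w by (simp add: powr_diff)
      ultimately have "w powr (p - 1) * (F - A powr p * (k * w + 1 - k)) / ((p - 1) * (1 - 1 / w))
          = w powr p * A powr p * k / (s * p + 1)"
        using s0 assms by simp
      then show ?thesis
        using hardy_functional_le[OF assms(4,5) w1] assms(2) by (simp add: A_def)
    next
      case True
      have "w = 1" "A = f" "F = f powr p" using True eq M by (auto simp: w_def A_def)
      \<comment> \<open>Since \<open>F = f powr p\<close> here, the numerator of the bound at
        parameter \<open>v\<close> is proportional to \<open>q 1 - q v\<close>. The bound thus
        becomes a difference quotient of \<open>q\<close>, and its limit as \<open>v\<close>
        decreases to 1 is given by the derivative \<open>k * (1 - p)\<close>.\<close>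
      define q where "q v = (k * v + 1 - k) powr (1 - p)" for v
      define b where "b v = v powr p * f powr p * (- ((q v - q 1) / (v - 1)) / (p - 1))" for v
      have "(q has_real_derivative k * (1 - p)) (at 1)"
        unfolding q_def by (auto intro!: derivative_eq_intros)
      then have "((\<lambda>v. (q v - q 1) / (v - 1)) \<longlongrightarrow> k * (1 - p)) (at_right 1)"
        unfolding has_field_derivative_iff by (rule tendsto_mono[OF at_le, rotated]) simp
      then have "(b \<longlongrightarrow> 1 powr p * f powr p * (- (k * (1 - p)) / (p - 1))) (at_right 1)"
        unfolding b_def using assms by (intro tendsto_intros) auto
      then have lim: "((\<lambda>v. ennreal (b v)) \<longlongrightarrow> ennreal (1 powr p * f powr p * (- (k * (1 - p)) / (p - 1)))) (at_right 1)"
        by (rule tendsto_ennrealI)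
      have "hardy_functional p k u \<le> ennreal (b v)" if v: "v > 1" for v
      proof -
        have "k * 1 < k * v" using v assms by (intro mult_strict_left_mono) auto
        then have D: "k * v + 1 - k > 0" by simp
        have "(f / (k * v + 1 - k)) powr p * (k * v + 1 - k) = f powr p * q v"
          using D assms by (simp add: q_def powr_divide powr_diff)
        moreover have "v powr (p - 1) = v powr p / v" "1 - 1 / v = (v - 1) / v"
          using v by (auto simp: powr_diff field_simps)
        moreover have "P / v * (G - G * Q) / (x * (z / v)) = P * G * (- ((Q - 1) / z) / x)"
          if "x \<noteq> 0" "z \<noteq> 0" for P G Q x z :: real
          using v that by (simp add: field_simps)
        moreover have "q 1 = 1" by (simp add: q_def)
        ultimately have "v powr (p - 1) * (F - (f / (k * v + 1 - k)) powr p * (k * v + 1 - k))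
            / ((p - 1) * (1 - 1 / v)) = b v"
          using v assms(1) \<open>F = f powr p\<close> unfolding b_def by simp
        then show ?thesis using hardy_functional_le[OF assms(4,5) v] assms(2) by simp
      qed
      then have "\<forall>\<^sub>F v in at_right 1. hardy_functional p k u \<le> ennreal (b v)"
        by (auto simp: eventually_at_filter)
      from tendsto_lowerbound[OF lim this]
      have "hardy_functional p k u \<le> ennreal (1 powr p * f powr p * (- (k * (1 - p)) / (p - 1)))" by simp
      also have "1 powr p * f powr p * (- (k * (1 - p)) / (p - 1)) = w powr p * A powr p * k / (s * p + 1)"
        using True \<open>w = 1\<close> \<open>A = f\<close> assms by (simp add: field_simps)
      finally show ?thesis .
    qed
  qed
  then have "S_sup p k f F \<le> hardy_functional p k g"
    unfolding S_sup_def hardy_g by (intro SUP_least) auto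
  moreover have "hardy_functional p k g \<le> S_sup p k f F"
    unfolding S_sup_def using adm by (intro SUP_upper) auto
  ultimately show ?thesis using adm cont by (intro exI[of _ g]) auto
qed

end
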